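(* Let $\mathcal{G}$ be a marked simple graph with countable vertex set $I$. For every $q\in\mathbb{Z}$ we have, as formal power series in $\mathbb{C}[[x_i:i\in I]]$, $$\mathcal{I}(\mathcal{G},\mathbf{x})^q=\sum_{\mathbf{m}\in \mathbb{Z}_+^{I}} {_{\mathbf{m}}\Pi^{\mathrm{mark}}_\mathcal{G}}(q)\ x^\mathbf{m}.$$
   Context: $\mathcal{G}$ has edge set $E$ and marking $I_1^{\mathrm{it}}\subseteq I_1\subseteq I$ (vertices of $I_1^{\mathrm{it}}$ are odd isotropic); $\mathbb{Z}_+^I$ denotes finitely supported tuples of non-negative integers and $x^{\mathbf{m}}=\prod_i x_i^{m_i}$. $\mathcal{I}(\mathcal{G})$ is the set of finite multisets $U$ of vertices such that distinct elements of $U$ are non-adjacent and vertices outside $I_1^{\mathrm{it}}$ occur at most once ($\emptyset$ included); $\mathcal{I}(\mathcal{G},\mathbf{x})=\sum_{U\in\mathcal{I}(\mathcal{G})}\prod_i x_i^{(\text{mult. of } i \text{ in } U)}$. For $q\in\mathbb{N}$, ${_{\mathbf{m}}\Pi^{\mathrm{mark}}_\mathcal{G}}(q)$ is the number of maps $\Gamma$ from $I$ to finite multisubsets of $\{1,\dots,q\}$ with $\Gamma(i)$ a set for $i\notin I_1^{\mathrm{it}}$, $|\Gamma(i)|=m_i$ (with multiplicity), and $\Gamma(i)\cap\Gamma(j)=\emptyset$ for adjacent $i,j$. For fixed $\mathbf{m}$ this function of $q\in\mathbb{N}$ is given by a polynomial in $q$ (the marked chromatic polynomial), and ${_{\mathbf{m}}\Pi^{\mathrm{mark}}_\mathcal{G}}(q)$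 for $q\in\mathbb{Z}$ means this polynomial evaluated at $q$; for $\mathbf{m}=0$ it is $1$. *)

theory Defs
  imports
    Complex_Main
    "HOL-Library.Multiset"
    "HOL-Library.FuncSet"
    "HOL-Library.Countable_Set"
    "HOL-Library.Poly_Mapping"
    "HOL-Computational_Algebra.Polynomial"
begin

section \<open>Formal power series in arbitrarily many variables\<close>

text \<open>A power series over \<^typ>\<open>'a\<close> in the variables \<open>x\<^sub>i\<close> (\<open>i :: 'v\<close>) is an arbitrary coefficient
  function on finitely supported exponent tuples.\<close>

typedef (overloaded) ('v, 'a :: zero) mfps = "UNIV :: (('v \<Rightarrow>\<^sub>0 nat) \<Rightarrow> 'a) set"
  morphisms mfps_coeff Abs_mfps
  by simp

setup_lifting type_definition_mfps

lemma mfps_eqI: "(\<And>n. mfps_coeff f n = mfps_coeff g n) \<Longrightarrow> f = g"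
  by (metis ext mfps_coeff_inject)

lemma mfps_coeff_Abs [simp]: "mfps_coeff (Abs_mfps f) = f"
  by (simp add: Abs_mfps_inverse)

definition splits :: "('v \<Rightarrow>\<^sub>0 nat) \<Rightarrow> (('v \<Rightarrow>\<^sub>0 nat) \<times> ('v \<Rightarrow>\<^sub>0 nat)) set" where
  "splits n = {(a, b). a + b = n}"

lemma finite_splits [simp]: "finite (splits n)"
proof -
  define B where "B = (\<lambda>i. {..Poly_Mapping.lookup n i})"
  let ?K = "Poly_Mapping.keys n"
  define D where "D = {a :: 'a \<Rightarrow>\<^sub>0 nat. \<forall>i. Poly_Mapping.lookup a i \<le> Poly_Mapping.lookup n i}"
  have "inj_on (\<lambda>a. restrict (Poly_Mapping.lookup a) ?K) D"
  proof (rule inj_onI)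
    fix a b :: "'a \<Rightarrow>\<^sub>0 nat"
    assume a: "a \<in> D" and b: "b \<in> D"
      and eq: "restrict (Poly_Mapping.lookup a) ?K = restrict (Poly_Mapping.lookup b) ?K"
    show "a = b"
    proof (rule poly_mapping_eqI)
      fix i
      show "Poly_Mapping.lookup a i = Poly_Mapping.lookup b i"
      proof (cases "i \<in> ?K")
        case True
        then show ?thesis using fun_cong[OF eq, of i] by simp
      next
        case False
        then have "Poly_Mapping.lookup n i = 0" by (simp add: in_keys_iff)
        then show ?thesis using a b unfolding D_def by (metis (mono_tags) le_zero_eq mem_Collect_eq)
      qed
    qed
  qed
  moreover have "(\<lambda>a. restrict (Poly_Mapping.lookup a) ?K) ` D \<subseteq> PiE ?K B"
    by (auto simp: D_def B_def)
  moreover have "finite (PiE ?K B)"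
    by (rule finite_PiE) (auto simp: B_def)
  ultimately have "finite D"
    by (meson finite_imageD finite_subset)
  moreover have "splits n \<subseteq> D \<times> D"
    by (auto simp: splits_def D_def lookup_add)
  ultimately show ?thesis
    by (meson finite_SigmaI finite_subset)
qed

instantiation mfps :: (type, comm_ring_1) comm_ring_1
begin

definition zero_mfps :: "('a, 'b) mfps" where
  "0 = Abs_mfps (\<lambda>n. 0)"

definition one_mfps :: "('a, 'b) mfps" where
  "1 = Abs_mfps (\<lambda>n. if n = 0 then 1 else 0)"

definition plus_mfps :: "('a, 'b) mfps \<Rightarrow> ('a, 'b) mfps \<Rightarrow> ('a, 'b) mfps" where
  "f + g = Abs_mfps (\<lambda>n. mfps_coeff f n + mfps_coeff g n)"

definition minus_mfps :: "('a, 'b) mfps \<Rightarrow> ('a, 'b) mfps \<Rightarrow> ('a, 'b) mfps" where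
  "f - g = Abs_mfps (\<lambda>n. mfps_coeff f n - mfps_coeff g n)"

definition uminus_mfps :: "('a, 'b) mfps \<Rightarrow> ('a, 'b) mfps" where
  "- f = Abs_mfps (\<lambda>n. - mfps_coeff f n)"

definition times_mfps :: "('a, 'b) mfps \<Rightarrow> ('a, 'b) mfps \<Rightarrow> ('a, 'b) mfps" where
  "f * g = Abs_mfps (\<lambda>n. \<Sum>(a, b)\<in>splits n. mfps_coeff f a * mfps_coeff g b)"

instance
proof
  fix f g h :: "('a, 'b) mfps"
  show "f + g + h = f + (g + h)" "f + g = g + f" "0 + f = f" "- f + f = 0" "f - g = f + - g"
    by (auto intro!: mfps_eqI simp: plus_mfps_def zero_mfps_def uminus_mfps_def minus_mfps_def)
  show "(0 :: ('a, 'b) mfps) \<noteq> 1"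
  proof
    assume "(0 :: ('a, 'b) mfps) = 1"
    then have "mfps_coeff (0 :: ('a, 'b) mfps) 0 = mfps_coeff 1 0"
      by (rule arg_cong)
    then show False
      by (simp add: zero_mfps_def one_mfps_def)
  qed
  show "(f + g) * h = f * h + g * h"
  proof (rule mfps_eqI)
    fix n :: "'a \<Rightarrow>\<^sub>0 nat"
    show "mfps_coeff ((f + g) * h) n = mfps_coeff (f * h + g * h) n"
      unfolding times_mfps_def plus_mfps_def mfps_coeff_Abs sum.distrib[symmetric]
      by (rule sum.cong) (auto simp: distrib_right)
  qed
  show "f * g = g * f"
  proof (rule mfps_eqI)
    fix n :: "'a \<Rightarrow>\<^sub>0 nat"
    show "mfps_coeff (f * g) n = mfps_coeff (g * f) n"
      unfolding times_mfps_def mfps_coeff_Abs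
      by (rule sum.reindex_bij_witness[of _ prod.swap prod.swap])
        (auto simp: splits_def intro: add.commute mult.commute)
  qed
  show "1 * f = f"
  proof (rule mfps_eqI)
    fix n :: "'a \<Rightarrow>\<^sub>0 nat"
    have "(\<Sum>(a, b)\<in>splits n. (if a = 0 then 1 else 0) * mfps_coeff f b)
        = (\<Sum>(a, b)\<in>{(0 :: 'a \<Rightarrow>\<^sub>0 nat, n)}. (if a = 0 then 1 else 0) * mfps_coeff f b)"
      by (rule sum.mono_neutral_right[OF finite_splits]) (auto simp: splits_def split: if_splits)
    then show "mfps_coeff (1 * f) n = mfps_coeff f n"
      by (simp add: times_mfps_def one_mfps_def)
  qed
  show "f * g * h = f * (g * h)"
  proof (rule mfps_eqI)
    fix n :: "'a \<Rightarrow>\<^sub>0 nat"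
    let ?F = "\<lambda>(c, d, b). mfps_coeff f c * mfps_coeff g d * mfps_coeff h b"
    have "mfps_coeff (f * g * h) n
        = (\<Sum>p\<in>splits n. \<Sum>r\<in>splits (fst p). ?F (fst r, snd r, snd p))"
      by (simp add: times_mfps_def sum_distrib_right case_prod_unfold)
    also have "\<dots> = (\<Sum>(p, r)\<in>Sigma (splits n) (\<lambda>p. splits (fst p)). ?F (fst r, snd r, snd p))"
      by (rule sum.Sigma) auto
    also have "\<dots> = (\<Sum>(p, r)\<in>Sigma (splits n) (\<lambda>p. splits (snd p)). ?F (fst p, fst r, snd r))"
      by (rule sum.reindex_bij_witness
          [of _ "\<lambda>(p, r). ((fst p + fst r, snd r), (fst p, fst r))"
                "\<lambda>(p, r). ((fst r, snd r + snd p), (snd r, snd p))"])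
        (auto simp: splits_def add.assoc)
    also have "\<dots> = (\<Sum>p\<in>splits n. \<Sum>r\<in>splits (snd p). ?F (fst p, fst r, snd r))"
      by (rule sum.Sigma[symmetric]) auto
    also have "\<dots> = mfps_coeff (f * (g * h)) n"
      by (simp add: times_mfps_def sum_distrib_left case_prod_unfold mult.assoc)
    finally show "mfps_coeff (f * g * h) n = mfps_coeff (f * (g * h)) n" .
  qed
qed

end

lemma mfps_coeff_zero [simp]: "mfps_coeff 0 n = 0"
  and mfps_coeff_one: "mfps_coeff 1 n = (if n = 0 then 1 else 0)"
  and mfps_coeff_add [simp]: "mfps_coeff (f + g) n = mfps_coeff f n + mfps_coeff g n"
  and mfps_coeff_diff [simp]: "mfps_coeff (f - g) n = mfps_coeff f n - mfps_coeff g n"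
  and mfps_coeff_uminus [simp]: "mfps_coeff (- f) n = - mfps_coeff f n"
  and mfps_coeff_mult:
    "mfps_coeff (f * g) n = (\<Sum>(a, b)\<in>splits n. mfps_coeff f a * mfps_coeff g b)"
  by (simp_all add: zero_mfps_def one_mfps_def plus_mfps_def minus_mfps_def uminus_mfps_def
      times_mfps_def)

text \<open>By convention, non-units get the inverse \<open>0\<close>. Series with constant term \<open>1\<close> are units; see
  \<open>mfps_mult_inverse\<close>.\<close>

instantiation mfps :: (type, field) inverse
begin

definition inverse_mfps :: "('a, 'b) mfps \<Rightarrow> ('a, 'b) mfps" where
  "inverse_mfps f = (if \<exists>g. f * g = 1 then THE g. f * g = 1 else 0)"

definition divide_mfps :: "('a, 'b) mfps \<Rightarrow> ('a, 'b) mfps \<Rightarrow> ('a, 'b) mfps" where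
  "divide_mfps f g = f * inverse g"

instance ..

end

lemma mfps_inverse_unique:
  fixes f g :: "('v, 'a :: field) mfps"
  assumes "f * g = 1"
  shows "inverse f = g"
proof -
  have "h = g" if "f * h = 1" for h
  proof -
    have "h = (f * g) * h" by (simp add: assms)
    also have "\<dots> = g * (f * h)" by (simp only: mult_ac)
    finally show ?thesis by (simp add: that)
  qed
  then have "(THE g. f * g = 1) = g"
    using assms by (intro the_equality)
  then show ?thesis
    using assms by (auto simp: inverse_mfps_def)
qed

definition mdeg :: "('v \<Rightarrow>\<^sub>0 nat) \<Rightarrow> nat" where
  "mdeg n = (\<Sum>i\<in>Poly_Mapping.keys n. Poly_Mapping.lookup n i)"

lemma mdeg_add: "mdeg (a + b) = mdeg a + mdeg b"
proof -
  let ?S = "Poly_Mapping.keys a \<union> Poly_Mapping.keys b"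
  have eq: "mdeg c = (\<Sum>i\<in>?S. Poly_Mapping.lookup c i)" if "Poly_Mapping.keys c \<subseteq> ?S" for c
    unfolding mdeg_def using that by (intro sum.mono_neutral_left) (auto simp: in_keys_iff)
  show ?thesis
    using eq[of a] eq[of b] eq[of "a + b"] keys_add[of a b]
    by (simp add: lookup_add sum.distrib)
qed

lemma mdeg_eq_0_iff [simp]: "mdeg n = 0 \<longleftrightarrow> n = 0"
  by (simp add: mdeg_def in_keys_iff poly_mapping_eq_iff fun_eq_iff)

lemma mfps_coeff_power_low:
  fixes u :: "('v, 'a :: comm_ring_1) mfps"
  assumes "mfps_coeff u 0 = 0" and "mdeg n < k"
  shows "mfps_coeff (u ^ k) n = 0"
  using assms(2)
proof (induction k arbitrary: n)
  case (Suc k)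
  have "mfps_coeff u a * mfps_coeff (u ^ k) b = 0" if "a + b = n" for a b
  proof (cases "a = 0")
    case False
    then have "mdeg b < k"
      using mdeg_add[of a b] mdeg_eq_0_iff[of a] Suc.prems unfolding that by linarith
    then show ?thesis by (simp add: Suc.IH)
  qed (simp add: assms(1))
  then show ?case
    by (auto simp: mfps_coeff_mult splits_def intro!: sum.neutral)
qed simp

lemma mfps_unit_one:
  fixes f :: "('v, 'a :: comm_ring_1) mfps"
  assumes "mfps_coeff f 0 = 1"
  shows "\<exists>g. f * g = 1"
proof -
  define u where "u = 1 - f"
  have u0: "mfps_coeff u 0 = 0" and f: "f = 1 - u"
    by (simp_all add: u_def assms mfps_coeff_one)
  define P where "P K = (\<Sum>k<Suc K. u ^ k)" for K
  have step: "mfps_coeff (P (Suc K)) n = mfps_coeff (P K) n" if "mdeg n \<le> K" for n K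
    using that mfps_coeff_power_low[OF u0, of n "Suc K"] unfolding P_def
    by (subst sum.lessThan_Suc) (simp del: sum.lessThan_Suc power_Suc)
  have stable: "mfps_coeff (P K) n = mfps_coeff (P (mdeg n)) n" if "mdeg n \<le> K" for n K
    using that by (induction K rule: dec_induct) (simp_all add: step)
  define g where "g = Abs_mfps (\<lambda>n. mfps_coeff (P (mdeg n)) n)"
  have tele: "f * P K = 1 - u ^ Suc K" for K
    unfolding f P_def by (rule one_diff_power_eq[symmetric])
  have "f * g = 1"
  proof (rule mfps_eqI)
    fix n :: "'v \<Rightarrow>\<^sub>0 nat"
    have "mfps_coeff (f * g) n = mfps_coeff (f * P (mdeg n)) n"
      unfolding mfps_coeff_mult
    proof (rule sum.cong)
      fix p assume "p \<in> splits n"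
      then have "mdeg (snd p) \<le> mdeg n"
        by (auto simp: splits_def mdeg_add)
      then show "(case p of (a, b) \<Rightarrow> mfps_coeff f a * mfps_coeff g b)
          = (case p of (a, b) \<Rightarrow> mfps_coeff f a * mfps_coeff (P (mdeg n)) b)"
        using stable[of "snd p" "mdeg n"] by (simp add: g_def case_prod_unfold)
    qed simp
    also have "\<dots> = mfps_coeff 1 n"
      unfolding tele by (simp add: mfps_coeff_power_low[OF u0] del: power_Suc)
    finally show "mfps_coeff (f * g) n = mfps_coeff 1 n" .
  qed
  then show ?thesis ..
qed

lemma mfps_mult_inverse:
  fixes f :: "('v, 'a :: field) mfps"
  assumes "mfps_coeff f 0 = 1"
  shows "f * inverse f = 1"
proof -
  obtain g where "f * g = 1"
    using mfps_unit_one[OF assms] ..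
  then show ?thesis
    using mfps_inverse_unique[of f g] by simp
qed

definition mfps_const :: "'a :: comm_ring_1 \<Rightarrow> ('v, 'a) mfps" where
  "mfps_const c = Abs_mfps (\<lambda>n. if n = 0 then c else 0)"

definition mfps_X :: "'v \<Rightarrow> ('v, 'a :: comm_ring_1) mfps" where
  "mfps_X i = Abs_mfps (\<lambda>n. if n = Poly_Mapping.single i 1 then 1 else 0)"

definition mfps_monom :: "('v \<Rightarrow>\<^sub>0 nat) \<Rightarrow> ('v, 'a :: comm_ring_1) mfps" where
  "mfps_monom m = (\<Prod>i\<in>Poly_Mapping.keys m. mfps_X i ^ Poly_Mapping.lookup m i)"

text \<open>The sum of a family \<open>F\<close> indexed by a possibly infinite set \<open>A\<close>, taken coefficientwise. It is
  meaningful when every coefficient is nonzero in only finitely many members of the family; the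
  families used below consist of scalar multiples of pairwise distinct monomials.\<close>

definition mfps_Sum :: "('b \<Rightarrow> ('v, 'a :: comm_ring_1) mfps) \<Rightarrow> 'b set \<Rightarrow> ('v, 'a) mfps" where
  "mfps_Sum F A = Abs_mfps (\<lambda>n. \<Sum>a\<in>{a \<in> A. mfps_coeff (F a) n \<noteq> 0}. mfps_coeff (F a) n)"

section \<open>Marked graphs\<close>

text \<open>\<open>I1\<close> is the set of odd vertices and \<open>I1it\<close> the set of odd isotropic vertices; an edge is
  the unordered pair of its two distinct ends.\<close>

locale marked_graph =
  fixes I :: "'v set" and E :: "'v set set" and I1 I1it :: "'v set"
  assumes edges: "e \<in> E \<Longrightarrow> e \<subseteq> I \<and> card e = 2"
    and marking: "I1it \<subseteq> I1" "I1 \<subseteq> I"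

definition indep_multisets :: "'v set \<Rightarrow> 'v set set \<Rightarrow> 'v set \<Rightarrow> 'v multiset set" where
  "indep_multisets I E I1it =
    {U. set_mset U \<subseteq> I
      \<and> (\<forall>i\<in>#U. \<forall>j\<in>#U. i \<noteq> j \<longrightarrow> {i, j} \<notin> E)
      \<and> (\<forall>i\<in>#U. i \<notin> I1it \<longrightarrow> count U i \<le> 1)}"

definition indep_series ::
    "'v set \<Rightarrow> 'v set set \<Rightarrow> 'v set \<Rightarrow> ('v, complex) mfps" where
  "indep_series I E I1it =
    mfps_Sum (\<lambda>U. \<Prod>i\<in>set_mset U. mfps_X i ^ count U i) (indep_multisets I E I1it)"

definition marked_colorings ::
    "'v set \<Rightarrow> 'v set set \<Rightarrow> 'v set \<Rightarrow> ('v \<Rightarrow>\<^sub>0 nat) \<Rightarrow> nat \<Rightarrow> ('v \<Rightarrow> nat multiset) set" where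
  "marked_colorings I E I1it m q =
    {\<Gamma> \<in> I \<rightarrow>\<^sub>E {M. set_mset M \<subseteq> {1..q}}.
      (\<forall>i\<in>I - I1it. \<forall>c\<in>#\<Gamma> i. count (\<Gamma> i) c = 1)
      \<and> (\<forall>i\<in>I. size (\<Gamma> i) = Poly_Mapping.lookup m i)
      \<and> (\<forall>i\<in>I. \<forall>j\<in>I. {i, j} \<in> E \<longrightarrow> \<Gamma> i \<inter># \<Gamma> j = {#})}"

text \<open>A complex polynomial is determined by its values at the natural numbers.\<close>

definition marked_chromatic_poly ::
    "'v set \<Rightarrow> 'v set set \<Rightarrow> 'v set \<Rightarrow> ('v \<Rightarrow>\<^sub>0 nat) \<Rightarrow> complex poly" where
  "marked_chromatic_poly I E I1it m =
    (THE p. \<forall>q. poly p (of_nat q) = of_nat (card (marked_colorings I E I1it m q)))"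

end

theory Submission
  imports Defs
begin

text \<open>A proper \<open>q\<close>-colouring of weight \<open>m\<close> is the same as its sequence of \<open>q\<close> colour classes, which
  are independent multisets adding up to \<open>m\<close>; this proves the identity for natural \<open>q\<close>. For a series
  \<open>f = 1 + u\<close> with constant term \<open>1\<close>, the binomial theorem shows that every coefficient of \<open>f ^ q\<close> is
  a polynomial in \<open>q\<close>. The recursion expressing the coefficients of \<open>f ^ (q + 1)\<close> by those of
  \<open>f ^ q\<close> is then a polynomial identity in \<open>q\<close>, so it persists for negative \<open>q\<close>, where it
  characterises the powers of the inverse.\<close>

section \<open>Coefficients of sums and monomials\<close>

lemma mfps_coeff_sum: "mfps_coeff (sum F A) n = (\<Sum>a\<in>A. mfps_coeff (F a) n)"
  by (induction A rule: infinite_finite_induct) auto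

lemma mfps_coeff_of_nat_mult: "mfps_coeff (of_nat c * f) n = of_nat c * mfps_coeff f n"
  by (induction c) (auto simp: distrib_right)

lemma mfps_coeff_const_mult:
  fixes f :: "('v, 'a :: comm_ring_1) mfps"
  shows "mfps_coeff (mfps_const c * f) n = c * mfps_coeff f n"
proof -
  have "mfps_coeff (mfps_const c * f) n
      = (\<Sum>(a, b)\<in>{(0 :: 'v \<Rightarrow>\<^sub>0 nat, n)}. mfps_coeff (mfps_const c) a * mfps_coeff f b)"
    unfolding mfps_coeff_mult
    by (rule sum.mono_neutral_right[OF finite_splits])
      (auto simp: splits_def mfps_const_def split: if_splits)
  then show ?thesis by (simp add: mfps_const_def)
qed

text \<open>Only the split \<open>(a, b)\<close> contributes, so multiplying monomials amounts to
  adding exponents.\<close>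

lemma mfps_indicator_mult:
  "Abs_mfps (\<lambda>n. if n = a then 1 else 0) * Abs_mfps (\<lambda>n. if n = b then 1 else 0)
    = (Abs_mfps (\<lambda>n. if n = a + b then 1 else 0) :: ('v, 'a :: comm_ring_1) mfps)"
  (is "?f * ?g = ?h")
proof (rule mfps_eqI)
  fix n :: "'v \<Rightarrow>\<^sub>0 nat"
  have "mfps_coeff (?f * ?g) n = (\<Sum>p\<in>splits n. if p = (a, b) then 1 else 0)"
    unfolding mfps_coeff_mult by (rule sum.cong) (auto split: if_splits)
  also have "\<dots> = mfps_coeff ?h n"
    by (simp add: sum.delta) (auto simp: splits_def)
  finally show "mfps_coeff (?f * ?g) n = mfps_coeff ?h n" .
qed

lemma mfps_X_power:
  "(mfps_X i :: ('v, 'a :: comm_ring_1) mfps) ^ k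
    = Abs_mfps (\<lambda>n. if n = Poly_Mapping.single i k then 1 else 0)"
proof (induction k)
  case 0
  show ?case by (simp add: one_mfps_def)
next
  case (Suc k)
  have "(mfps_X i :: ('v, 'a) mfps) ^ Suc k
      = mfps_X i * Abs_mfps (\<lambda>n. if n = Poly_Mapping.single i k then 1 else 0)"
    by (simp add: Suc.IH)
  also have "\<dots> = Abs_mfps (\<lambda>n. if n = Poly_Mapping.single i (Suc k) then 1 else 0)"
    unfolding mfps_X_def mfps_indicator_mult by (simp add: single_add[symmetric])
  finally show ?case .
qed

text \<open>Exponents add up over \<open>A\<close>. For infinite \<open>A\<close> the product
  defaults to 1 and the exponent sum to 0, and these agree.\<close>

lemma mfps_coeff_prod_X_power:
  fixes A :: "'v set" and e :: "'v \<Rightarrow> nat"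
  shows "mfps_coeff (\<Prod>i\<in>A. mfps_X i ^ e i :: ('v, 'a :: comm_ring_1) mfps) n
    = (if n = (\<Sum>i\<in>A. Poly_Mapping.single i (e i)) then 1 else 0)"
proof -
  have "(\<Prod>i\<in>A. mfps_X i ^ e i :: ('v, 'a) mfps)
      = Abs_mfps (\<lambda>n. if n = (\<Sum>i\<in>A. Poly_Mapping.single i (e i)) then 1 else 0)"
  proof (induction A rule: infinite_finite_induct)
    case (insert x A)
    then show ?case by (simp add: mfps_X_power mfps_indicator_mult)
  qed (simp_all add: one_mfps_def)
  then show ?thesis by simp
qed

lemma eq_sum_single_iff:
  assumes "finite A" "\<And>i. i \<notin> A \<Longrightarrow> e i = 0"
  shows "n = (\<Sum>i\<in>A. Poly_Mapping.single i (e i)) \<longleftrightarrow> Poly_Mapping.lookup n = e"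
proof -
  have "Poly_Mapping.lookup (\<Sum>i\<in>A. Poly_Mapping.single i (e i)) = e"
    using assms by (auto simp: lookup_sum lookup_single when_def fun_eq_iff)
  then show ?thesis by (metis poly_mapping_eqI)
qed

lemma mfps_coeff_monom: "mfps_coeff (mfps_monom m) n = (if n = m then 1 else 0)"
  unfolding mfps_monom_def mfps_coeff_prod_X_power
  by (subst eq_sum_single_iff) (auto simp: in_keys_iff lookup_inject)

lemma mfps_coeff_Sum_monom:
  "mfps_coeff (mfps_Sum (\<lambda>m. mfps_const (c m) * mfps_monom m) A) n = (if n \<in> A then c n else 0)"
proof -
  have "{m \<in> A. mfps_coeff (mfps_const (c m) * mfps_monom m) n \<noteq> 0}
      = (if n \<in> A \<and> c n \<noteq> 0 then {n} else {})"
    by (auto simp: mfps_coeff_const_mult mfps_coeff_monom split: if_splits)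
  then show ?thesis
    by (simp add: mfps_Sum_def mfps_coeff_const_mult mfps_coeff_monom)
qed

section \<open>Integer powers of a series with constant term one\<close>

text \<open>Otherwise the difference would be a nonzero polynomial with every natural number as a
  root, and in characteristic zero these are infinitely many.\<close>

lemma poly_eqI_of_nat:
  fixes p r :: "'a :: field_char_0 poly"
  assumes "\<And>k :: nat. poly p (of_nat k) = poly r (of_nat k)"
  shows "p = r"
proof (rule ccontr)
  assume "p \<noteq> r"
  then have "finite {x. poly (p - r) x = 0}"
    by (intro poly_roots_finite) simp
  moreover have "range (of_nat :: nat \<Rightarrow> 'a) \<subseteq> {x. poly (p - r) x = 0}"
    using assms by auto
  ultimately have "finite (range (of_nat :: nat \<Rightarrow> 'a))"
    by (rule finite_subset[rotated])
  then show False
    by (simp add: finite_image_iff inj_of_nat)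
qed

lemma ex_gbinomial_poly: "\<exists>p :: 'a :: field_char_0 poly. \<forall>x. poly p x = x gchoose k"
  by (rule exI[of _ "smult (1 / fact k) (\<Prod>i = 0..<k. [:- of_nat i, 1:])"])
    (simp add: poly_prod gbinomial_prod_rev)

text \<open>The series \<open>f - 1\<close> has no constant term, so its \<open>j\<close>-th power
  starts in degree \<open>j\<close> at the earliest. The binomial expansion can therefore be cut off
  at \<open>mdeg n\<close>, a bound independent of \<open>k\<close>; this is what makes the
  coefficient polynomial in \<open>k\<close>.\<close>

lemma mfps_coeff_power_binomial:
  fixes f :: "('v, 'a :: comm_ring_1) mfps"
  assumes "mfps_coeff f 0 = 1"
  shows "mfps_coeff (f ^ k) n = (\<Sum>j\<le>mdeg n. of_nat (k choose j) * mfps_coeff ((f - 1) ^ j) n)"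
proof -
  let ?t = "\<lambda>j. of_nat (k choose j) * mfps_coeff ((f - 1) ^ j) n"
  have u0: "mfps_coeff (f - 1) 0 = 0"
    by (simp add: assms mfps_coeff_one)
  have "f ^ k = ((f - 1) + 1) ^ k"
    by simp
  also have "\<dots> = (\<Sum>j\<le>k. of_nat (k choose j) * (f - 1) ^ j)"
    by (subst binomial_ring) simp
  finally have "mfps_coeff (f ^ k) n = (\<Sum>j\<le>k. ?t j)"
    by (simp add: mfps_coeff_sum mfps_coeff_of_nat_mult)
  \<comment> \<open>Either bound may be the larger one: the sum is first extended to the maximum,
    the binomial coefficients with \<open>j > k\<close> being zero, and then shortened to
    \<open>mdeg n\<close>.\<close>
  also have "\<dots> = (\<Sum>j\<le>max k (mdeg n). ?t j)"
  proof (rule sum.mono_neutral_left)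
    have "?t j = 0" if "j > k" for j
      using that by (simp add: binomial_eq_0)
    then show "\<forall>j\<in>{..max k (mdeg n)} - {..k}. ?t j = 0"
      by auto
  qed auto
  also have "\<dots> = (\<Sum>j\<le>mdeg n. ?t j)"
    by (rule sum.mono_neutral_right) (auto simp: mfps_coeff_power_low[OF u0])
  finally show ?thesis .
qed

lemma mfps_coeff_power_poly:
  fixes f :: "('v, 'a :: field_char_0) mfps"
  assumes "mfps_coeff f 0 = 1"
  shows "\<exists>p. \<forall>k. mfps_coeff (f ^ k) n = poly p (of_nat k)"
proof -
  obtain B :: "nat \<Rightarrow> 'a poly" where B: "\<And>j x. poly (B j) x = x gchoose j"
    using ex_gbinomial_poly by metis
  show ?thesis
    by (rule exI[of _ "\<Sum>j\<le>mdeg n. smult (mfps_coeff ((f - 1) ^ j) n) (B j)"])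
      (simp add: mfps_coeff_power_binomial[OF assms] poly_sum B binomial_gbinomial mult.commute)
qed

text \<open>The rule \<open>f ^ Suc k = f * f ^ k\<close> holds at all natural \<open>k\<close>,
  hence as an identity between the polynomials \<open>p n\<close>, and can then be run backwards
  below zero.\<close>

lemma mfps_coeff_power_int_poly:
  fixes f :: "('v, 'a :: field_char_0) mfps"
  assumes f0: "mfps_coeff f 0 = 1"
    and p: "\<And>n k. mfps_coeff (f ^ k) n = poly (p n) (of_nat k)"
  shows "mfps_coeff (f powi q) n = poly (p n) (of_int q)"
proof -
  \<comment> \<open>\<open>G x\<close> plays the role of \<open>f\<close> raised to an arbitrary
    scalar \<open>x\<close>.\<close>
  define G where "G x = Abs_mfps (\<lambda>n. poly (p n) x)" for x
  have G_nat: "G (of_nat k) = f ^ k" for k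
    by (rule mfps_eqI) (simp add: G_def p)
  \<comment> \<open>Composition with \<open>[:1, 1:]\<close> substitutes \<open>x + 1\<close> for
    \<open>x\<close>. The right side is a polynomial because \<open>splits n\<close> is
    finite.\<close>
  have rec: "pcompose (p n) [:1, 1:] = (\<Sum>(a, b)\<in>splits n. smult (mfps_coeff f a) (p b))" for n
  proof (rule poly_eqI_of_nat)
    fix k :: nat
    have "mfps_coeff (f ^ Suc k) n = (\<Sum>(a, b)\<in>splits n. mfps_coeff f a * mfps_coeff (f ^ k) b)"
      by (simp add: mfps_coeff_mult)
    then show "poly (pcompose (p n) [:1, 1:]) (of_nat k)
        = poly (\<Sum>(a, b)\<in>splits n. smult (mfps_coeff f a) (p b)) (of_nat k)"
      unfolding p by (simp add: poly_pcompose poly_sum case_prod_unfold)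
  qed
  have G_Suc: "G (x + 1) = f * G x" for x
  proof (rule mfps_eqI)
    fix n
    have "poly (p n) (x + 1) = poly (pcompose (p n) [:1, 1:]) x"
      by (simp add: poly_pcompose add.commute)
    then show "mfps_coeff (G (x + 1)) n = mfps_coeff (f * G x) n"
      by (simp add: rec G_def mfps_coeff_mult poly_sum case_prod_unfold)
  qed
  have inv: "inverse f * f = 1"
    using mfps_mult_inverse[OF f0] by (simp add: mult.commute)
  \<comment> \<open>At \<open>x = - of_nat (Suc k)\<close> the recursion reads
    \<open>G (- of_nat k) = f * G (- of_nat (Suc k))\<close>, and multiplying by
    \<open>inverse f\<close> cancels \<open>f\<close>.\<close>
  have G_neg: "G (- of_nat k) = inverse f ^ k" for k
  proof (induction k)
    case 0
    show ?case using G_nat[of 0] by simp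
  next
    case (Suc k)
    have "inverse f * G (- of_nat k) = inverse f * f * G (- of_nat (Suc k))"
      using G_Suc[of "- of_nat (Suc k)"] by (simp add: mult.assoc)
    then show ?case
      by (simp add: inv Suc.IH del: of_nat_Suc)
  qed
  have "f powi q = G (of_int q)"
  proof (cases "q \<ge> 0")
    case True
    then show ?thesis using G_nat[of "nat q"] by (simp add: power_int_def)
  next
    case False
    then show ?thesis using G_neg[of "nat (- q)"] by (simp add: power_int_def)
  qed
  then show ?thesis by (simp add: G_def)
qed

section \<open>Independent multisets and colourings\<close>

text \<open>This is \<open>indep_multisets\<close> transported along \<open>count\<close>, so that
  independence can be tested directly on a component of a split.\<close>

definition indep_exponents :: "'v set \<Rightarrow> 'v set set \<Rightarrow> 'v set \<Rightarrow> ('v \<Rightarrow>\<^sub>0 nat) set" where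
  "indep_exponents I E I1it =
    {a. Poly_Mapping.keys a \<subseteq> I
      \<and> (\<forall>i\<in>Poly_Mapping.keys a. \<forall>j\<in>Poly_Mapping.keys a. i \<noteq> j \<longrightarrow> {i, j} \<notin> E)
      \<and> (\<forall>i\<in>Poly_Mapping.keys a. i \<notin> I1it \<longrightarrow> Poly_Mapping.lookup a i \<le> 1)}"

text \<open>A multiset is recovered from its monomial, whose exponent is \<open>count\<close>. Hence
  exactly one multiset \<open>U\<close> has exponent \<open>n\<close>, and it contributes 1 or is
  absent.\<close>

lemma mfps_coeff_indep_series:
  "mfps_coeff (indep_series I E I1it) n = (if n \<in> indep_exponents I E I1it then 1 else 0)"
proof -
  define U where "U = Abs_multiset (Poly_Mapping.lookup n)"
  have count_U: "count U = Poly_Mapping.lookup n"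
    unfolding U_def using finite_lookup[of n] by (intro Abs_multiset_inverse) simp
  have set_U: "set_mset U = Poly_Mapping.keys n"
    by (auto simp: set_mset_def count_U in_keys_iff)
  have coeff: "mfps_coeff (\<Prod>i\<in>set_mset V. mfps_X i ^ count V i) n = (if V = U then 1 else 0 :: complex)"
    for V
    unfolding mfps_coeff_prod_X_power
    by (subst eq_sum_single_iff) (auto simp: count_U[symmetric] not_in_iff count_inject)
  have "U \<in> indep_multisets I E I1it \<longleftrightarrow> n \<in> indep_exponents I E I1it"
    by (simp add: indep_multisets_def indep_exponents_def count_U set_U)
  then have "{V \<in> indep_multisets I E I1it. (if V = U then 1 else 0 :: complex) \<noteq> 0}
      = (if n \<in> indep_exponents I E I1it then {U} else {})"
    by auto
  then show ?thesis
    by (simp add: indep_series_def mfps_Sum_def coeff)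
qed

section \<open>Counting colourings by removing the last colour class\<close>

lemma marked_colorings_0:
  assumes "Poly_Mapping.keys m \<subseteq> I"
  shows "marked_colorings I E I1it m 0 = (if m = 0 then {\<lambda>i\<in>I. {#}} else {})"
proof -
  have empty: "\<Gamma> i = {#}" if "\<Gamma> \<in> marked_colorings I E I1it m 0" "i \<in> I" for \<Gamma> i
    using that by (auto simp: marked_colorings_def PiE_iff)
  show ?thesis
  proof (cases "m = 0")
    case True
    have "\<Gamma> = (\<lambda>i\<in>I. {#})" if \<Gamma>: "\<Gamma> \<in> marked_colorings I E I1it m 0" for \<Gamma>
    proof
      fix i
      show "\<Gamma> i = (\<lambda>i\<in>I. {#}) i"
        using \<Gamma> empty[OF \<Gamma>, of i]
        by (cases "i \<in> I") (auto simp: marked_colorings_def PiE_iff extensional_def)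
    qed
    moreover have "(\<lambda>i\<in>I. {#}) \<in> marked_colorings I E I1it m 0"
      using True by (simp add: marked_colorings_def)
    ultimately have "marked_colorings I E I1it m 0 = {\<lambda>i\<in>I. {#}}"
      by blast
    then show ?thesis
      using True by simp
  next
    case False
    \<comment> \<open>Colourings constrain \<open>m\<close> only on \<open>I\<close>, so the nonzero
      component has to be located there.\<close>
    then obtain i where "Poly_Mapping.lookup m i \<noteq> 0"
      by (metis lookup_zero poly_mapping_eqI)
    moreover from this have "i \<in> I"
      using assms by (auto simp: in_keys_iff)
    ultimately have "\<Gamma> \<notin> marked_colorings I E I1it m 0" for \<Gamma>
      using empty[of \<Gamma> i] by (auto simp: marked_colorings_def)
    then show ?thesis
      using False by auto
  qed
qed

text \<open>The class of the colour \<open>Suc q\<close>, with multiplicities, is an independent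
  exponent \<open>a\<close>; deleting it leaves a colouring with \<open>q\<close> colours of weight
  \<open>b\<close>, where \<open>a + b = m\<close>. Both the marking and the adjacency condition can
  be checked one colour at a time. The index set mirrors the product of the series with its
  \<open>q\<close>-th power.\<close>

lemma bij_betw_marked_colorings_Suc:
  assumes graph: "marked_graph I E I1 I1it"
  shows "bij_betw (\<lambda>((a, b), \<Delta>). \<lambda>i\<in>I. \<Delta> i + replicate_mset (Poly_Mapping.lookup a i) (Suc q))
    (SIGMA p:{p \<in> splits m. fst p \<in> indep_exponents I E I1it}. marked_colorings I E I1it (snd p) q)
    (marked_colorings I E I1it m (Suc q))"
proof -
  \<comment> \<open>The value is set to 0 off \<open>I\<close>, where a colouring is
    \<open>undefined\<close>. \<open>Abs_poly_mapping\<close> returns the intended function only for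
    finite support, which the bound by \<open>m\<close> provides.\<close>
  define cls where "cls \<Gamma> = Abs_poly_mapping (\<lambda>i. if i \<in> I then count (\<Gamma> i) (Suc q) else 0)"
    for \<Gamma> :: "'a \<Rightarrow> nat multiset"
  have lookup_cls: "Poly_Mapping.lookup (cls \<Gamma>) = (\<lambda>i. if i \<in> I then count (\<Gamma> i) (Suc q) else 0)"
    if "\<forall>i\<in>I. count (\<Gamma> i) (Suc q) \<le> Poly_Mapping.lookup m i" for \<Gamma>
  proof -
    have "{i. (if i \<in> I then count (\<Gamma> i) (Suc q) else 0) \<noteq> 0} \<subseteq> Poly_Mapping.keys m"
    proof
      fix i assume "i \<in> {i. (if i \<in> I then count (\<Gamma> i) (Suc q) else 0) \<noteq> 0}"
      then have i: "i \<in> I" "count (\<Gamma> i) (Suc q) \<noteq> 0"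
        by (simp_all split: if_splits)
      then show "i \<in> Poly_Mapping.keys m"
        using bspec[OF that i(1)] unfolding in_keys_iff by linarith
    qed
    then have "finite {i. (if i \<in> I then count (\<Gamma> i) (Suc q) else 0) \<noteq> 0}"
      by (rule finite_subset) simp
    then show ?thesis
      unfolding cls_def by simp
  qed
  \<comment> \<open>Independence restricts only distinct vertices, whereas colourings restrict every
    pair in \<open>E\<close>; the two match because edges have two distinct ends.\<close>
  have loop: "{i, j} \<notin> E" if "i = j" for i j
    using marked_graph.edges[OF graph, of "{i, j}"] that by auto
  have fresh: "count (\<Delta> i) (Suc q) = 0" if "\<Delta> \<in> marked_colorings I E I1it b q" "i \<in> I" for \<Delta> b i
  proof -
    have "set_mset (\<Delta> i) \<subseteq> {1..q}"
      using that by (auto simp: marked_colorings_def PiE_iff)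
    then show ?thesis by (auto simp: not_in_iff[symmetric])
  qed
  define glue where "glue a \<Delta> = (\<lambda>i\<in>I. \<Delta> i + replicate_mset (Poly_Mapping.lookup a i) (Suc q))"
    for a :: "'a \<Rightarrow>\<^sub>0 nat" and \<Delta> :: "'a \<Rightarrow> nat multiset"
  define rest where "rest \<Gamma> = (\<lambda>i\<in>I. filter_mset (\<lambda>c. c \<noteq> Suc q) (\<Gamma> i))"
    for \<Gamma> :: "'a \<Rightarrow> nat multiset"
  have glue_in: "glue a \<Delta> \<in> marked_colorings I E I1it m (Suc q)"
    and cls_glue: "cls (glue a \<Delta>) = a" and rest_glue: "rest (glue a \<Delta>) = \<Delta>"
    if m: "m = a + b" and a: "a \<in> indep_exponents I E I1it"
      and \<Delta>: "\<Delta> \<in> marked_colorings I E I1it b q" for a b \<Delta>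
  proof -
    have \<Delta>_set: "set_mset (\<Delta> i) \<subseteq> {1..q}" if "i \<in> I" for i
      using \<Delta> that by (auto simp: marked_colorings_def PiE_iff)
    have count_glue: "count (glue a \<Delta> i) c
        = (if c = Suc q then Poly_Mapping.lookup a i else count (\<Delta> i) c)" if "i \<in> I" for i c
      using fresh[OF \<Delta> that] that by (simp add: glue_def)
    show "glue a \<Delta> \<in> marked_colorings I E I1it m (Suc q)"
      unfolding marked_colorings_def mem_Collect_eq
    proof (intro conjI ballI impI)
      show "glue a \<Delta> \<in> I \<rightarrow>\<^sub>E {M. set_mset M \<subseteq> {1..Suc q}}"
        using \<Delta>_set by (fastforce simp: glue_def PiE_iff split: if_splits)
    next
      fix i c assume i: "i \<in> I - I1it" and c: "c \<in># glue a \<Delta> i"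
      show "count (glue a \<Delta> i) c = 1"
      proof (cases "c = Suc q")
        case True
        then have "Poly_Mapping.lookup a i \<noteq> 0"
          using c i count_glue[of i c] by (simp add: count_greater_zero_iff[symmetric] del: count_greater_zero_iff)
        then have "Poly_Mapping.lookup a i = 1"
          using a i by (simp add: indep_exponents_def in_keys_iff le_Suc_eq)
        then show ?thesis using True i by (simp add: count_glue)
      next
        case False
        then have "c \<in># \<Delta> i"
          using c i by (auto simp: glue_def split: if_splits)
        then show ?thesis
          using False i \<Delta> by (simp add: count_glue marked_colorings_def)
      qed
    next
      fix i assume "i \<in> I"
      then show "size (glue a \<Delta> i) = Poly_Mapping.lookup m i"
        using \<Delta> by (simp add: glue_def m lookup_add marked_colorings_def)
    next
      fix i j assume ij: "i \<in> I" "j \<in> I" "{i, j} \<in> E"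
      then have disj: "\<Delta> i \<inter># \<Delta> j = {#}"
        using \<Delta> by (simp add: marked_colorings_def)
      \<comment> \<open>This handles the new colour: an independent exponent cannot be nonzero at
        both ends of an edge. The old colours are handled by \<open>disj\<close>.\<close>
      have "Poly_Mapping.lookup a i = 0 \<or> Poly_Mapping.lookup a j = 0"
        using a ij(3) loop[of i j] unfolding indep_exponents_def mem_Collect_eq by (metis in_keys_iff)
      moreover have "min (count (\<Delta> i) c) (count (\<Delta> j) c) = 0" for c
        using disj by (metis count_empty count_inter_mset)
      ultimately show "glue a \<Delta> i \<inter># glue a \<Delta> j = {#}"
        using ij by (intro multiset_eqI) (auto simp: count_glue)
    qed
    have "\<forall>i\<in>I. count (glue a \<Delta> i) (Suc q) \<le> Poly_Mapping.lookup m i"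
      by (simp add: count_glue m lookup_add)
    from lookup_cls[OF this] show "cls (glue a \<Delta>) = a"
      using a by (intro poly_mapping_eqI) (auto simp: count_glue indep_exponents_def in_keys_iff)
    show "rest (glue a \<Delta>) = \<Delta>"
    proof
      fix i
      show "rest (glue a \<Delta>) i = \<Delta> i"
      proof (cases "i \<in> I")
        case True
        then show ?thesis
          using fresh[OF \<Delta> True] by (intro multiset_eqI) (simp add: rest_def count_glue)
      next
        case False
        then show ?thesis
          using \<Delta> by (auto simp: rest_def marked_colorings_def PiE_iff extensional_def)
      qed
    qed
  qed
  have cls_in: "cls \<Gamma> \<in> indep_exponents I E I1it" and cls_le: "cls \<Gamma> + (m - cls \<Gamma>) = m"
    and rest_in: "rest \<Gamma> \<in> marked_colorings I E I1it (m - cls \<Gamma>) q"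
    and glue_rest: "glue (cls \<Gamma>) (rest \<Gamma>) = \<Gamma>"
    if \<Gamma>: "\<Gamma> \<in> marked_colorings I E I1it m (Suc q)" for \<Gamma>
  proof -
    have sz: "size (\<Gamma> i) = Poly_Mapping.lookup m i" if "i \<in> I" for i
      using \<Gamma> that by (simp add: marked_colorings_def)
    have le: "\<forall>i\<in>I. count (\<Gamma> i) (Suc q) \<le> Poly_Mapping.lookup m i"
      using sz by (metis count_le_size)
    note lk = lookup_cls[OF le]
    \<comment> \<open>At the colour \<open>Suc q\<close> this yields independence of the class, at
      the other colours properness of the remaining colouring.\<close>
    have disj: "min (count (\<Gamma> i) c) (count (\<Gamma> j) c) = 0" if "i \<in> I" "j \<in> I" "{i, j} \<in> E" for i j c
    proof -
      have "\<Gamma> i \<inter># \<Gamma> j = {#}"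
        using \<Gamma> that by (simp add: marked_colorings_def)
      then show ?thesis by (metis count_empty count_inter_mset)
    qed
    have one: "count (\<Gamma> i) c \<le> 1" if "i \<in> I" "i \<notin> I1it" for i c
    proof (cases "c \<in># \<Gamma> i")
      case True
      then show ?thesis using \<Gamma> that by (simp add: marked_colorings_def)
    qed (simp add: not_in_iff)
    show "cls \<Gamma> \<in> indep_exponents I E I1it"
      unfolding indep_exponents_def mem_Collect_eq
    proof (intro conjI ballI impI)
      show "Poly_Mapping.keys (cls \<Gamma>) \<subseteq> I"
        by (auto simp: in_keys_iff lk split: if_splits)
    next
      fix i j assume "i \<in> Poly_Mapping.keys (cls \<Gamma>)" "j \<in> Poly_Mapping.keys (cls \<Gamma>)"
      then show "{i, j} \<notin> E"
        using disj[of i j "Suc q"] by (auto simp: in_keys_iff lk min_def count_eq_zero_iff split: if_splits)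
    next
      fix i assume "i \<in> Poly_Mapping.keys (cls \<Gamma>)" "i \<notin> I1it"
      then show "Poly_Mapping.lookup (cls \<Gamma>) i \<le> 1"
        using one[of i "Suc q"] by (simp add: lk)
    qed
    \<comment> \<open>Subtraction of exponents is truncated; \<open>le\<close> ensures that nothing
      is cut off.\<close>
    show "cls \<Gamma> + (m - cls \<Gamma>) = m"
      using le by (intro poly_mapping_eqI) (auto simp: lookup_add lookup_minus lk)
    have split: "filter_mset (\<lambda>c. c \<noteq> Suc q) (\<Gamma> i) + replicate_mset (count (\<Gamma> i) (Suc q)) (Suc q) = \<Gamma> i"
      for i
      by (rule multiset_eqI) simp
    show "glue (cls \<Gamma>) (rest \<Gamma>) = \<Gamma>"
    proof
      fix i
      show "glue (cls \<Gamma>) (rest \<Gamma>) i = \<Gamma> i"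
        using \<Gamma> split by (auto simp: glue_def rest_def lk marked_colorings_def PiE_iff extensional_def)
    qed
    show "rest \<Gamma> \<in> marked_colorings I E I1it (m - cls \<Gamma>) q"
      unfolding marked_colorings_def mem_Collect_eq
    proof (intro conjI ballI impI)
      have "set_mset (\<Gamma> i) \<subseteq> {1..Suc q}" if "i \<in> I" for i
        using \<Gamma> that by (auto simp: marked_colorings_def PiE_iff)
      then show "rest \<Gamma> \<in> I \<rightarrow>\<^sub>E {M. set_mset M \<subseteq> {1..q}}"
        by (fastforce simp: rest_def PiE_iff)
    next
      fix i c assume "i \<in> I - I1it" "c \<in># rest \<Gamma> i"
      then show "count (rest \<Gamma> i) c = 1"
        using \<Gamma> by (auto simp: rest_def marked_colorings_def)
    next
      fix i assume i: "i \<in> I"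
      have "size (rest \<Gamma> i) + count (\<Gamma> i) (Suc q) = Poly_Mapping.lookup m i"
        using arg_cong[OF split[of i], of size] i by (simp add: rest_def sz)
      then show "size (rest \<Gamma> i) = Poly_Mapping.lookup (m - cls \<Gamma>) i"
        using i by (simp add: lookup_minus lk)
    next
      fix i j assume "i \<in> I" "j \<in> I" "{i, j} \<in> E"
      then show "rest \<Gamma> i \<inter># rest \<Gamma> j = {#}"
        using disj by (intro multiset_eqI) (auto simp: rest_def)
    qed
  qed
  let ?A = "SIGMA p:{p \<in> splits m. fst p \<in> indep_exponents I E I1it}. marked_colorings I E I1it (snd p) q"
  show ?thesis
    unfolding glue_def[symmetric]
  proof (rule bij_betw_byWitness[where f' = "\<lambda>\<Gamma>. ((cls \<Gamma>, m - cls \<Gamma>), rest \<Gamma>)"])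
    have "glue (fst (fst x)) (snd x) \<in> marked_colorings I E I1it m (Suc q)" if "x \<in> ?A" for x
    proof -
      obtain a b \<Delta> where x: "x = ((a, b), \<Delta>)"
        by (metis surj_pair)
      with that have "a + b = m" "a \<in> indep_exponents I E I1it" "\<Delta> \<in> marked_colorings I E I1it b q"
        by (simp_all add: splits_def)
      from glue_in[OF this(1)[symmetric] this(2,3)] show ?thesis
        by (simp add: x)
    qed
    then show "(\<lambda>((a, b), \<Delta>). glue a \<Delta>) ` ?A \<subseteq> marked_colorings I E I1it m (Suc q)"
      by (simp add: image_subset_iff case_prod_unfold)
  qed (auto simp: splits_def cls_glue rest_glue cls_in cls_le rest_in glue_rest)
qed

text \<open>Multiplying by the series once more prepends one independent exponent, which the
  bijection turns into one more colour. The case distinction matters because colourings ignore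
  \<open>m\<close> off \<open>I\<close>, while the power has no monomial with support leaving
  \<open>I\<close>.\<close>

lemma mfps_coeff_indep_series_power:
  assumes graph: "marked_graph I E I1 I1it"
  shows "mfps_coeff (indep_series I E I1it ^ q) m
    = (if Poly_Mapping.keys m \<subseteq> I then of_nat (card (marked_colorings I E I1it m q)) else 0)"
proof -
  let ?C = "marked_colorings I E I1it" and ?P = "indep_exponents I E I1it"
  \<comment> \<open>With \<open>I\<close> possibly infinite, finiteness comes from the finite
    support of \<open>m\<close>: the bijection reduces it to finitely many splits and fewer
    colours.\<close>
  have fin: "finite (?C m q)" if "Poly_Mapping.keys m \<subseteq> I" for m q
    using that
  proof (induction q arbitrary: m)
    case 0
    then show ?case by (simp add: marked_colorings_0)
  next
    case (Suc q)
    have "Poly_Mapping.keys (snd p) \<subseteq> I" if "p \<in> splits m" for p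
      using that Suc.prems by (force simp: splits_def in_keys_iff lookup_add)
    then show ?case
      using bij_betw_finite[OF bij_betw_marked_colorings_Suc[OF graph, where m = m and q = q]] Suc.IH
      by auto
  qed
  show ?thesis
  proof (induction q arbitrary: m)
    case 0
    show ?case by (simp add: mfps_coeff_one marked_colorings_0)
  next
    case (Suc q)
    \<comment> \<open>Natural exponents cannot cancel, so the support of a sum is the union of the
      supports.\<close>
    have keys_iff: "Poly_Mapping.keys m \<subseteq> I \<longleftrightarrow> Poly_Mapping.keys (fst p) \<subseteq> I \<and> Poly_Mapping.keys (snd p) \<subseteq> I"
      if "p \<in> splits m" for p
      using that by (force simp: splits_def in_keys_iff lookup_add subset_iff)
    have "mfps_coeff (indep_series I E I1it ^ Suc q) m
        = (\<Sum>p\<in>splits m. if fst p \<in> ?P then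
            (if Poly_Mapping.keys (snd p) \<subseteq> I then of_nat (card (?C (snd p) q)) else 0) else 0)"
      by (auto simp: mfps_coeff_mult mfps_coeff_indep_series Suc.IH case_prod_unfold intro!: sum.cong)
    also have "\<dots> = (\<Sum>p\<in>{p \<in> splits m. fst p \<in> ?P}.
        if Poly_Mapping.keys m \<subseteq> I then of_nat (card (?C (snd p) q)) else 0)"
      unfolding sum.inter_filter[OF finite_splits, symmetric]
    proof (rule sum.cong)
      fix p assume "p \<in> {p \<in> splits m. fst p \<in> ?P}"
      then have "Poly_Mapping.keys m \<subseteq> I \<longleftrightarrow> Poly_Mapping.keys (snd p) \<subseteq> I"
        using keys_iff[of p] by (simp add: indep_exponents_def)
      then show "(if Poly_Mapping.keys (snd p) \<subseteq> I then of_nat (card (?C (snd p) q)) else 0)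
          = (if Poly_Mapping.keys m \<subseteq> I then of_nat (card (?C (snd p) q)) else (0 :: complex))"
        by simp
    qed simp
    also have "\<dots> = (if Poly_Mapping.keys m \<subseteq> I then of_nat (card (?C m (Suc q))) else 0)"
    proof (cases "Poly_Mapping.keys m \<subseteq> I")
      case True
      have "card (?C m (Suc q)) = (\<Sum>p\<in>{p \<in> splits m. fst p \<in> ?P}. card (?C (snd p) q))"
        using True keys_iff fin
        by (subst bij_betw_same_card[OF bij_betw_marked_colorings_Suc[OF graph, where m = m and q = q], symmetric])
          (simp add: card_SigmaI)
      then show ?thesis using True by simp
    qed simp
    finally show ?case .
  qed
qed

theorem theorem3p3:
  fixes I :: "'v set" and E :: "'v set set" and I1 I1it :: "'v set" and q :: int
  assumes "marked_graph I E I1 I1it" and "countable I"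
  shows "indep_series I E I1it powi q =
    mfps_Sum (\<lambda>m. mfps_const (poly (marked_chromatic_poly I E I1it m) (of_int q)) * mfps_monom m)
      {m. Poly_Mapping.keys m \<subseteq> I}"
proof (rule mfps_eqI)
  fix n :: "'v \<Rightarrow>\<^sub>0 nat"
  let ?S = "indep_series I E I1it"
  \<comment> \<open>The constant term comes from the empty multiset.\<close>
  have S0: "mfps_coeff ?S 0 = 1"
    by (simp add: mfps_coeff_indep_series indep_exponents_def)
  obtain p where p: "\<And>n k. mfps_coeff (?S ^ k) n = poly (p n) (of_nat k)"
    using mfps_coeff_power_poly[OF S0] by metis
  note colorings = mfps_coeff_indep_series_power[OF assms(1), unfolded p]
  have lhs: "mfps_coeff (?S powi q) n = poly (p n) (of_int q)"
    by (rule mfps_coeff_power_int_poly[OF S0 p])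
  show "mfps_coeff (?S powi q) n = mfps_coeff (mfps_Sum
      (\<lambda>m. mfps_const (poly (marked_chromatic_poly I E I1it m) (of_int q)) * mfps_monom m)
      {m. Poly_Mapping.keys m \<subseteq> I}) n"
  proof (cases "Poly_Mapping.keys n \<subseteq> I")
    case True
    then have "\<forall>k. poly (p n) (of_nat k) = of_nat (card (marked_colorings I E I1it n k))"
      by (simp add: colorings)
    \<comment> \<open>The coefficient polynomial witnesses existence for the definite description,
      and agreement at the natural numbers gives uniqueness.\<close>
    then have "marked_chromatic_poly I E I1it n = p n"
      unfolding marked_chromatic_poly_def by (intro the_equality poly_eqI_of_nat) simp_all
    then show ?thesis
      using True by (simp add: lhs mfps_coeff_Sum_monom)
  next
    case False
    \<comment> \<open>The coefficient vanishes in every natural power, so its polynomial is zero and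
      it vanishes in the negative powers too.\<close>
    then have "p n = 0"
      by (intro poly_eqI_of_nat) (simp add: colorings)
    then show ?thesis
      using False by (simp add: lhs mfps_coeff_Sum_monom)
  qed
qed

end
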